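(* For any $\mathbf{x}\in B_1$ and $z\geq1$, $$e^{i\kappa\mathbf{d}_{\uparrow}(z)\cdot\mathbf{x}}=4\pi\sum_{\ell=0}^{\infty}i^{\ell}\sum_{m=-\ell}^{\ell}Y_\ell^m(\mathbf{d}_{\uparrow}(z))\,Y_\ell^m(\hat{\mathbf{x}})\,j_\ell(\kappa|\mathbf{x}|).$$ Hence, for any $\mathbf{x}\in B_1$ and $\mathbf{y}=(\boldsymbol{\theta},\zeta)\in\Theta\times[0,+\infty)$, $$\phi_{\mathbf{y}}(\mathbf{x})=e^{i\kappa\mathbf{d}(\mathbf{y})\cdot\mathbf{x}}=4\pi\sum_{\ell=0}^{\infty}i^{\ell}\sum_{m=-\ell}^{\ell}Y_\ell^m\Big(\mathbf{d}_{\uparrow}\big(\tfrac{\zeta}{2\kappa}+1\big)\Big)\,Y_\ell^m\big(R_{\boldsymbol{\theta}}^{-1}\hat{\mathbf{x}}\big)\,j_\ell(\kappa|\mathbf{x}|).$$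
   Context: $\kappa>0$; $B_1$ is the open unit ball of $\mathbb{R}^3$, $\mathbb{S}^2$ the unit sphere, $\hat{\mathbf{x}}:=\mathbf{x}/|\mathbf{x}|$. The dot product on $\mathbb{C}^3$ is bilinear (no conjugation). $j_\ell(r)=\sqrt{\pi/(2r)}\,J_{\ell+1/2}(r)$ is the spherical Bessel function of the first kind (extended by continuity to $r=0$). Ferrers functions, for $0\le|m|\le\ell$, $|x|\le1$: $\mathsf{P}_\ell^m(x):=\frac{(-1)^m}{2^\ell\ell!}(1-x^2)^{m/2}\frac{\mathrm{d}^{\ell+m}}{\mathrm{d}x^{\ell+m}}(x^2-1)^\ell$. Put $\gamma_\ell^m:=\left[\frac{2\ell+1}{4\pi}\frac{(\ell-m)!}{(\ell+m)!}\right]^{1/2}$. Spherical harmonics: $Y_\ell^m(\hat{\mathbf{x}}):=\gamma_\ell^me^{im\theta_2}\mathsf{P}_\ell^m(\cos\theta_1)$ for $\hat{\mathbf{x}}=(\sin\theta_1\cos\theta_2,\sin\theta_1\sin\theta_2,\cos\theta_1)\in\mathbb{S}^2$. Associated Legendre polynomials, for $z\ge1$: $P_\ell^m(z):=\frac{1}{2^\ell\ell!}(z^2-1)^{m/2}\frac{\mathrm{d}^{\ell+m}}{\mathrm{d}z^{\ell+m}}(z^2-1)^\ell$ with nonnegative real powers, so that $P_\ell^{-m}(z)=\frac{(\ell-m)!}{(\ell+m)!}P_\ell^m(z)$. Reference complex direction: $\mathbf{d}_{\uparrow}(z):=(i\sqrt{z^2-1},0,z)\in\mathbb{C}^3$,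 $z\ge1$; and one defines $Y_\ell^m(\mathbf{d}_{\uparrow}(z)):=\gamma_\ell^m\,i^{-m}P_\ell^m(z)$. $\Theta:=[0,\pi]\times[0,2\pi)\times[0,2\pi)$; for $\boldsymbol{\theta}=(\theta_1,\theta_2,\theta_3)\in\Theta$, $R_{\boldsymbol{\theta}}:=R_z(\theta_2)R_y(\theta_1)R_z(\theta_3)$ with $$R_y(\theta)=\begin{bmatrix}\cos\theta&0&\sin\theta\\0&1&0\\-\sin\theta&0&\cos\theta\end{bmatrix},\quad R_z(\theta)=\begin{bmatrix}\cos\theta&-\sin\theta&0\\\sin\theta&\cos\theta&0\\0&0&1\end{bmatrix}.$$ For $\mathbf{y}=(\boldsymbol{\theta},\zeta)\in\Theta\times[0,+\infty)$: $\mathbf{d}(\mathbf{y}):=R_{\boldsymbol{\theta}}\,\mathbf{d}_{\uparrow}(\frac{\zeta}{2\kappa}+1)\in\mathbb{C}^3$, and the evanescent plane wave is $\phi_{\mathbf{y}}(\mathbf{x}):=e^{i\kappa\mathbf{d}(\mathbf{y})\cdot\mathbf{x}}$. At $\mathbf{x}=0$ the choice of $\hat{\mathbf{x}}$ is immaterial since $j_\ell(0)=0$ for $\ell\ge1$ and $Y_0^0$ is constant. *)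

theory Defs
  imports "HOL-Analysis.Analysis"
begin

text \<open>The half-integer powers \<open>(1 - x\<^sup>2)\<^bsup>m/2\<^esup>\<close> are written as integer powers of the square root. Since
  \<open>0 powi 0 = 1\<close> and \<open>0 powi m = 0\<close> for negative \<open>m\<close>, the values at the end points \<open>\<bar>x\<bar> = 1\<close> are the
  continuous extensions, which \<^const>\<open>powr\<close> would not give for \<open>m = 0\<close>.\<close>

definition ferrers :: "nat \<Rightarrow> int \<Rightarrow> real \<Rightarrow> real" where
  "ferrers l m x = (-1) powi m / (2 ^ l * fact l) * sqrt (1 - x\<^sup>2) powi m *
     (deriv ^^ nat (int l + m)) (\<lambda>t. (t\<^sup>2 - 1) ^ l) x"

definition assoc_legendre :: "nat \<Rightarrow> int \<Rightarrow> real \<Rightarrow> real" where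
  "assoc_legendre l m z = 1 / (2 ^ l * fact l) * sqrt (z\<^sup>2 - 1) powi m *
     (deriv ^^ nat (int l + m)) (\<lambda>t. (t\<^sup>2 - 1) ^ l) z"

definition sph_norm :: "nat \<Rightarrow> int \<Rightarrow> real" where
  "sph_norm l m = sqrt ((2 * real l + 1) / (4 * pi) *
     (fact (nat (int l - m)) / fact (nat (int l + m))))"

definition sph_point :: "real \<Rightarrow> real \<Rightarrow> real ^ 3" where
  "sph_point \<theta>1 \<theta>2 = vector [sin \<theta>1 * cos \<theta>2, sin \<theta>1 * sin \<theta>2, cos \<theta>1]"

text \<open>A function on the unit sphere; the lemma \<open>sph_harm_sph_point\<close> below shows that the value does
  not depend on the chosen angles.\<close>

definition sph_harm :: "nat \<Rightarrow> int \<Rightarrow> real ^ 3 \<Rightarrow> complex" where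
  "sph_harm l m u =
     (let (\<theta>1, \<theta>2) = (SOME (\<theta>1, \<theta>2). 0 \<le> \<theta>1 \<and> \<theta>1 \<le> pi \<and> 0 \<le> \<theta>2 \<and> \<theta>2 < 2 * pi \<and> u = sph_point \<theta>1 \<theta>2)
      in of_real (sph_norm l m) * exp (\<i> * of_int m * of_real \<theta>2) * of_real (ferrers l m (cos \<theta>1)))"

definition bessel_J :: "real \<Rightarrow> real \<Rightarrow> real" where
  "bessel_J \<nu> r =
     (\<Sum>k. (-1) ^ k / fact k * rGamma (\<nu> + real k + 1) * (r / 2) powr (2 * real k + \<nu>))"

definition sph_bessel :: "nat \<Rightarrow> real \<Rightarrow> real" where
  "sph_bessel l r =
     (if r = 0 then Lim (at_right 0) (\<lambda>s. sqrt (pi / (2 * s)) * bessel_J (real l + 1 / 2) s)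
      else sqrt (pi / (2 * r)) * bessel_J (real l + 1 / 2) r)"

definition d_up :: "real \<Rightarrow> complex ^ 3" where
  "d_up z = vector [\<i> * of_real (sqrt (z\<^sup>2 - 1)), 0, of_real z]"

text \<open>\<open>sph_harm_d_up l m z\<close> is the value of the spherical harmonic at the complex direction \<open>d_up z\<close>.\<close>

definition sph_harm_d_up :: "nat \<Rightarrow> int \<Rightarrow> real \<Rightarrow> complex" where
  "sph_harm_d_up l m z =
     of_real (sph_norm l m) * \<i> powi (- m) * of_real (assoc_legendre l m z)"

text \<open>The inner product of the library on \<open>complex ^ 3\<close> is real-valued, hence the bilinear product
  is introduced here.\<close>

definition cdot :: "complex ^ 3 \<Rightarrow> complex ^ 3 \<Rightarrow> complex" where
  "cdot a b = (\<Sum>i\<in>UNIV. a $ i * b $ i)"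

definition cvec :: "real ^ 3 \<Rightarrow> complex ^ 3" where
  "cvec x = (\<chi> i. of_real (x $ i))"

definition rot_y :: "real \<Rightarrow> real ^ 3 ^ 3" where
  "rot_y \<theta> = vector [vector [cos \<theta>, 0, sin \<theta>],
                     vector [0, 1, 0],
                     vector [- sin \<theta>, 0, cos \<theta>]]"

definition rot_z :: "real \<Rightarrow> real ^ 3 ^ 3" where
  "rot_z \<theta> = vector [vector [cos \<theta>, - sin \<theta>, 0],
                     vector [sin \<theta>, cos \<theta>, 0],
                     vector [0, 0, 1]]"

definition Theta :: "(real \<times> real \<times> real) set" where
  "Theta = {0..pi} \<times> {0..<2 * pi} \<times> {0..<2 * pi}"

definition rot :: "real \<times> real \<times> real \<Rightarrow> real ^ 3 ^ 3" where
  "rot = (\<lambda>(\<theta>1, \<theta>2, \<theta>3). rot_z \<theta>2 ** rot_y \<theta>1 ** rot_z \<theta>3)"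

definition direction :: "real \<Rightarrow> (real \<times> real \<times> real) \<times> real \<Rightarrow> complex ^ 3" where
  "direction \<kappa> = (\<lambda>(\<theta>, \<zeta>). map_matrix of_real (rot \<theta>) *v d_up (\<zeta> / (2 * \<kappa>) + 1))"

definition plane_wave :: "real \<Rightarrow> complex ^ 3 \<Rightarrow> real ^ 3 \<Rightarrow> complex" where
  "plane_wave \<kappa> d x = exp (\<i> * of_real \<kappa> * cdot d (cvec x))"

definition evanescent_wave :: "real \<Rightarrow> (real \<times> real \<times> real) \<times> real \<Rightarrow> real ^ 3 \<Rightarrow> complex" where
  "evanescent_wave \<kappa> y = plane_wave \<kappa> (direction \<kappa> y)"

lemma sph_point_eq_iff:
  "sph_point a b = sph_point c d \<longleftrightarrow>
     sin a * cos b = sin c * cos d \<and> sin a * sin b = sin c * sin d \<and> cos a = cos c"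
  by (auto simp: sph_point_def vec_eq_iff forall_3)

lemma exp_int_angle: "exp (\<i> * of_int m * of_real t) = cis t powi m"
  by (simp add: cis_power_int) (simp add: cis_conv_exp mult_ac)

lemma ferrers_pole: "m \<noteq> 0 \<Longrightarrow> x\<^sup>2 = 1 \<Longrightarrow> ferrers l m x = 0"
  by (simp add: ferrers_def)

lemma sph_harm_sph_point:
  assumes "0 \<le> \<theta>1" "\<theta>1 \<le> pi"
  shows "sph_harm l m (sph_point \<theta>1 \<theta>2) =
    of_real (sph_norm l m) * exp (\<i> * of_int m * of_real \<theta>2) * of_real (ferrers l m (cos \<theta>1))"
proof -
  define P where "P = (\<lambda>(a, b). 0 \<le> a \<and> a \<le> pi \<and> 0 \<le> b \<and> b < 2 * pi \<and>
    sph_point \<theta>1 \<theta>2 = sph_point a b)"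
  obtain b where b: "0 \<le> b" "b < 2 * pi" "cis b = cis \<theta>2"
  proof
    show "0 \<le> Arg2pi (cis \<theta>2)" "Arg2pi (cis \<theta>2) < 2 * pi"
      using Arg2pi by blast+
    show "cis (Arg2pi (cis \<theta>2)) = cis \<theta>2"
      using complex_norm_eq_1_exp[of "cis \<theta>2"] by (simp add: cis_conv_exp)
  qed
  have "P (\<theta>1, b)"
    using assms b by (auto simp: P_def sph_point_eq_iff cis.ctr)
  then have "P (SOME p. P p)"
    by (rule someI)
  then obtain a c where ac: "(SOME p. P p) = (a, c)" "P (a, c)"
    by (cases "SOME p. P p") simp
  have a: "a = \<theta>1"
    using ac assms by (auto simp: P_def sph_point_eq_iff intro: cos_inj_pi)
  have "exp (\<i> * of_int m * of_real c) * of_real (ferrers l m (cos \<theta>1)) =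
        exp (\<i> * of_int m * of_real \<theta>2) * complex_of_real (ferrers l m (cos \<theta>1))"
  proof (cases "sin \<theta>1 = 0")
    case True
    then have "(cos \<theta>1)\<^sup>2 = 1"
      by (simp add: cos_squared_eq)
    then show ?thesis
      by (cases "m = 0") (simp_all add: ferrers_pole)
  next
    case False
    then have "cis c = cis \<theta>2"
      using ac a by (auto simp: P_def sph_point_eq_iff cis.ctr)
    then show ?thesis
      by (simp add: exp_int_angle)
  qed
  moreover have "sph_harm l m (sph_point \<theta>1 \<theta>2) =
    (case (SOME p. P p) of (s, t) \<Rightarrow>
      of_real (sph_norm l m) * exp (\<i> * of_int m * of_real t) * of_real (ferrers l m (cos s)))"
    by (simp add: sph_harm_def P_def Let_def)
  ultimately show ?thesis
    using ac a by auto
qed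

end

theory Submission
  imports Defs "HOL-Computational_Algebra.Polynomial"
begin

text \<open>Expanding \<open>w ^ n\<close> in Legendre polynomials inside the exponential series gives the plane wave
  expansion \<open>exp (i r w) = (\<Sum>l. (2 l + 1) i\<^sup>l P\<^sub>l(w) j\<^sub>l(r))\<close> for every complex \<open>w\<close>; the double series
  converges absolutely because \<open>P\<^sub>l(w)\<close> grows at most geometrically in \<open>l\<close>.

  What remains is the addition theorem for \<open>P\<^sub>l(w)\<close>, where \<open>w\<close> is the bilinear product of a complex
  direction with a unit vector. By Rodrigues' formula and Taylor expansion, the functions
  \<open>l! / (l + m)! P\<^sub>l\<^sup>m\<close> are the coefficients of the \<open>l\<close>-th power of a quadratic polynomial of discriminant 1.
  Summing over \<open>m\<close> therefore computes the apolar pairing of two such powers, viewed as binary forms of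
  degree \<open>2 l\<close>. This pairing is invariant under shears, which reduce the second quadratic form to the product
  of the two variables; the pairing then extracts the middle coefficient of a power of a quadratic of
  discriminant 1, which is a Legendre polynomial. The second half follows from the first, as
  the rotation can be moved from the direction to the point.\<close>

section \<open>Powers of quadratic polynomials and the apolar pairing\<close>

lemma coeff_quadratic_mult:
  fixes a b c :: "'a::comm_semiring_1"
  shows "coeff ([:a, b, c:] * p) j =
    a * coeff p j + (if j \<ge> 1 then b * coeff p (j - 1) else 0) + (if j \<ge> 2 then c * coeff p (j - 2) else 0)"
  by (auto simp: coeff_pCons add_ac numeral_2_eq_2 split: nat.splits)

lemma degree_quadratic_power_le: "degree ([:a, b, c:] ^ l) \<le> 2 * l"
  for a b c :: "'a::comm_semiring_1"
proof -
  have "degree ([:a, b, c:] ^ l) \<le> degree [:a, b, c:] * l"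
    by (rule degree_power_le)
  also have "\<dots> \<le> 2 * l"
    by (intro mult_right_mono) (auto simp: degree_pCons_eq_if)
  finally show ?thesis .
qed

lemma coeff_quadratic_power_eq_0: "2 * l < j \<Longrightarrow> coeff ([:a, b, c:] ^ l) j = 0"
  for a b c :: "'a::comm_semiring_1"
  using degree_quadratic_power_le[of a b c l] by (intro coeff_eq_0) linarith

text \<open>Replacing t by 1 / t and multiplying by t^(2 l) swaps the outer coefficients. The
  reversal is relative to the formal degree \<open>2 * l\<close>, since the actual degree drops when
  \<open>c\<close> vanishes.\<close>

lemma coeff_quadratic_power_reflect:
  fixes a b c :: "'a::comm_semiring_1"
  assumes "j \<le> 2 * l"
  shows "coeff ([:a, b, c:] ^ l) j = coeff ([:c, b, a:] ^ l) (2 * l - j)"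
  using assms
proof (induction l arbitrary: j)
  case (Suc l)
  let ?p = "[:a, b, c:] ^ l" and ?q = "[:c, b, a:] ^ l"
  have z: "coeff ?p j = 0" "coeff ?q j = 0" if "2 * l < j" for j
    using that by (simp_all add: coeff_quadratic_power_eq_0)
  have 1: "coeff ?p j = (if j \<le> 2 * l then coeff ?q (2 * l - j) else 0)" for j
    using Suc.IH[of j] z by auto
  have "coeff ([:c, b, a:] * ?q) (2 * l + 2 - j) =
     (if j \<ge> 2 then c * coeff ?q (2 * l + 2 - j) else 0)
     + (if j \<ge> 1 \<and> j \<le> 2 * l + 1 then b * coeff ?q (2 * l + 1 - j) else 0)
     + (if j \<le> 2 * l then a * coeff ?q (2 * l - j) else 0)"
    using Suc.prems unfolding coeff_quadratic_mult
    by (auto simp: z Suc_diff_le)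
  also have "\<dots> = coeff ([:a, b, c:] * ?p) j"
    using Suc.prems unfolding coeff_quadratic_mult 1
    by (cases j; cases "j - 1"; cases l) (auto simp: add_ac Suc_diff_le numeral_2_eq_2)
  finally show ?case
    by simp
qed auto

lemma pcompose_power: "pcompose (p ^ n) q = pcompose p q ^ n"
  for p q :: "'a::comm_semiring_1 poly"
  by (induction n) (simp_all add: pcompose_1 pcompose_mult)

lemma coeff_quadratic_power_scale:
  fixes a b c k :: "'a::comm_semiring_1"
  shows "coeff ([:a, b * k, c * k ^ 2:] ^ l) j = k ^ j * coeff ([:a, b, c:] ^ l) j"
proof -
  have "[:a, b * k, c * k ^ 2:] = pcompose [:a, b, c:] [:0, k:]"
    by (simp add: pcompose_pCons power2_eq_square mult_ac)
  then show ?thesis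
    by (simp add: pcompose_power flip: coeff_pcompose_linear)
qed

lemma coeff_linear_power_choose:
  "coeff ([:c, 1:] ^ n) i = of_nat (n choose i) * c ^ (n - i)"
  for c :: "'a::comm_ring_1"
proof (cases "i \<le> n")
  case False
  then have "degree ([:c, 1:] ^ n) < i"
    by (simp add: degree_linear_power)
  then show ?thesis
    using False by (simp add: coeff_eq_0 binomial_eq_0)
qed (simp add: coeff_linear_poly_power)

lemma coeff_pcompose_shift:
  fixes p :: "'a::comm_ring_1 poly"
  assumes "degree p \<le> n"
  shows "coeff (pcompose p [:c, 1:]) j = (\<Sum>i\<le>n. coeff p i * (of_nat (i choose j) * c ^ (i - j)))"
proof -
  have "pcompose p [:c, 1:] = (\<Sum>i\<le>n. smult (coeff p i) ([:c, 1:] ^ i))"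
    by (subst poly_as_sum_of_monoms'[OF assms, symmetric])
       (simp add: pcompose_sum pcompose_smult pcompose_power monom_altdef pcompose_pCons)
  then show ?thesis
    by (auto simp: coeff_sum coeff_linear_power_choose intro!: sum.cong)
qed

lemma coeff_quadratic_power_shift:
  fixes a b d c :: "'a::comm_ring_1"
  shows "coeff ([:a + b * c + d * c ^ 2, b + 2 * d * c, d:] ^ l) j =
    (\<Sum>i\<le>2 * l. coeff ([:a, b, d:] ^ l) i * (of_nat (i choose j) * c ^ (i - j)))"
proof -
  have "[:a + b * c + d * c ^ 2, b + 2 * d * c, d:] = pcompose [:a, b, d:] [:c, 1:]"
    by (simp add: pcompose_pCons power2_eq_square algebra_simps)
  then show ?thesis
    by (simp add: coeff_pcompose_shift degree_quadratic_power_le flip: pcompose_power)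
qed

section \<open>The apolar pairing and its values on powers of quadratics\<close>

text \<open>With both polynomials homogenised to binary forms of degree \<open>n\<close>, this is
  the form \<open>p\<close> in the partial derivatives, applied to the form
  \<open>q\<close>.\<close>

definition apolar :: "nat \<Rightarrow> 'a::field_char_0 poly \<Rightarrow> 'a poly \<Rightarrow> 'a" where
  "apolar n p q = (\<Sum>j\<le>n. fact j * fact (n - j) * coeff p j * coeff q j)"

lemma apolar_commute: "apolar n p q = apolar n q p"
  by (simp add: apolar_def mult_ac)

text \<open>The two quadratics are \<open>q(t + c)\<close> and \<open>(1 + c t)\<^sup>2 q'(t / (1 + c t))\<close>: transposed shears are
  adjoint for the pairing.\<close>

lemma apolar_shift:
  fixes a b d a' b' d' c :: "'a::field_char_0"
  shows "apolar (2 * l) ([:a + b * c + d * c ^ 2, b + 2 * d * c, d:] ^ l) ([:a', b', d':] ^ l) =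
    apolar (2 * l) ([:a, b, d:] ^ l) ([:a', b' + 2 * a' * c, d' + b' * c + a' * c ^ 2:] ^ l)"
proof -
  let ?p = "\<lambda>i. coeff ([:a, b, d:] ^ l) i" and ?q = "\<lambda>i. coeff ([:a', b', d':] ^ l) i"
  \<comment> \<open>Reflection turns the transposed shear into a translation, to which the shift
    formula applies; reversing the summation index undoes the reflection.\<close>
  have star: "coeff ([:a', b' + 2 * a' * c, d' + b' * c + a' * c ^ 2:] ^ l) i =
      (\<Sum>j\<le>2 * l. ?q j * (of_nat ((2 * l - j) choose (2 * l - i)) * c ^ ((2 * l - j) - (2 * l - i))))"
    if i: "i \<le> 2 * l" for i
  proof -
    have "coeff ([:a', b' + 2 * a' * c, d' + b' * c + a' * c ^ 2:] ^ l) i =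
      coeff ([:d' + b' * c + a' * c ^ 2, b' + 2 * a' * c, a':] ^ l) (2 * l - i)"
      by (rule coeff_quadratic_power_reflect[OF i])
    also have "\<dots> = (\<Sum>j\<le>2 * l. coeff ([:d', b', a':] ^ l) j *
        (of_nat (j choose (2 * l - i)) * c ^ (j - (2 * l - i))))"
      by (rule coeff_quadratic_power_shift)
    also have "\<dots> = (\<Sum>j\<le>2 * l. coeff ([:d', b', a':] ^ l) (2 * l - j) *
        (of_nat ((2 * l - j) choose (2 * l - i)) * c ^ ((2 * l - j) - (2 * l - i))))"
      by (rule sum.reindex_bij_witness[of _ "\<lambda>j. 2 * l - j" "\<lambda>j. 2 * l - j"]) auto
    also have "\<dots> = (\<Sum>j\<le>2 * l. ?q j *
        (of_nat ((2 * l - j) choose (2 * l - i)) * c ^ ((2 * l - j) - (2 * l - i))))"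
      by (intro sum.cong refl) (simp add: coeff_quadratic_power_reflect[of _ l a'])
    finally show ?thesis .
  qed
  \<comment> \<open>Adjointness, entry by entry: with n = 2 l, both sides are i! (n - j)! / (i - j)!
    times c^(i - j) if j \<le> i, and 0 otherwise.\<close>
  have key: "fact j * fact (2 * l - j) * (of_nat (i choose j) * c ^ (i - j)) =
      fact i * fact (2 * l - i) * (of_nat ((2 * l - j) choose (2 * l - i)) * c ^ ((2 * l - j) - (2 * l - i)))"
    if "i \<le> 2 * l" "j \<le> 2 * l" for i j
  proof (cases "j \<le> i")
    case True
    then show ?thesis
      using that by (simp add: binomial_fact field_simps)
  next
    case False
    then show ?thesis
      using that by (simp add: binomial_eq_0)
  qed
  have "apolar (2 * l) ([:a + b * c + d * c ^ 2, b + 2 * d * c, d:] ^ l) ([:a', b', d':] ^ l) =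
     (\<Sum>j\<le>2 * l. \<Sum>i\<le>2 * l. ?p i * ?q j * (fact j * fact (2 * l - j) * (of_nat (i choose j) * c ^ (i - j))))"
    unfolding apolar_def coeff_quadratic_power_shift
    by (simp add: sum_distrib_left sum_distrib_right mult_ac)
  also have "\<dots> = (\<Sum>i\<le>2 * l. \<Sum>j\<le>2 * l. ?p i * ?q j * (fact j * fact (2 * l - j) * (of_nat (i choose j) * c ^ (i - j))))"
    by (rule sum.swap)
  also have "\<dots> = (\<Sum>i\<le>2 * l. \<Sum>j\<le>2 * l. ?p i * ?q j * (fact i * fact (2 * l - i) *
      (of_nat ((2 * l - j) choose (2 * l - i)) * c ^ ((2 * l - j) - (2 * l - i)))))"
    by (intro sum.cong refl) (subst key, auto)
  also have "\<dots> = apolar (2 * l) ([:a, b, d:] ^ l) ([:a', b' + 2 * a' * c, d' + b' * c + a' * c ^ 2:] ^ l)"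
    unfolding apolar_def
    by (intro sum.cong refl, subst star) (auto simp: sum_distrib_left mult_ac)
  finally show ?thesis .
qed

text \<open>The coefficient of \<open>t\<^sup>l\<close> in \<open>((t + (w + 1) / 2) (t + (w - 1) / 2))\<^sup>l\<close>; by
  \<open>legendre_0\<close>, \<open>legendre_1\<close> and \<open>legendre_rec\<close> below it is the Legendre polynomial.\<close>

definition legendre :: "nat \<Rightarrow> 'a::field_char_0 \<Rightarrow> 'a" where
  "legendre l w = coeff ([:(w ^ 2 - 1) / 4, w, 1:] ^ l) l"

text \<open>Replacing t by t / b and multiplying by b preserves the middle coefficient of the power,
  which therefore depends only on \<open>w\<close> and \<open>a * b\<close>, and the discriminant
  determines \<open>a * b\<close>. If \<open>b = 0\<close>, both middle coefficients are
  \<open>w ^ l\<close>.\<close>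

lemma middle_coeff_eq_legendre:
  fixes a w b :: "'a::field_char_0"
  assumes "w ^ 2 - 4 * a * b = 1"
  shows "coeff ([:a, w, b:] ^ l) l = legendre l w"
proof (cases "b = 0")
  case True
  have 1: "[:0, w, 1:] ^ l = monom 1 l * [:w, 1:] ^ l"
  proof -
    have "[:0, w, 1:] = monom 1 1 * [:w, 1:]"
      by (simp add: monom_altdef)
    then have "[:0, w, 1:] ^ l = monom 1 1 ^ l * [:w, 1:] ^ l"
      by (simp only: power_mult_distrib)
    then show ?thesis
      by (simp only: monom_power) simp
  qed
  have "coeff ([:0, w, 1:] ^ l) l = w ^ l"
    unfolding 1 by (simp add: coeff_monom_mult coeff_linear_poly_power)
  moreover have "coeff ([:a, w:] ^ l) l = w ^ l"
    by (simp add: coeff_linear_poly_power)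
  ultimately show ?thesis
    using assms True by (simp add: legendre_def)
next
  case False
  have ab: "(w ^ 2 - 1) / 4 = a * b"
    unfolding assms[symmetric] by simp
  have "[:a * b, w, 1:] = smult b [:a, w * (1 / b), b * (1 / b) ^ 2:]"
    using False by (simp add: power2_eq_square)
  then have "coeff ([:a * b, w, 1:] ^ l) l = b ^ l * coeff ([:a, w * (1 / b), b * (1 / b) ^ 2:] ^ l) l"
    by (metis smult_power coeff_smult)
  also have "\<dots> = coeff ([:a, w, b:] ^ l) l"
    unfolding coeff_quadratic_power_scale using False by (simp add: power_divide)
  finally show ?thesis
    unfolding legendre_def ab by simp
qed

lemma apolar_monom:
  assumes "i \<le> n"
  shows "apolar n p (monom 1 i) = fact i * fact (n - i) * coeff p i"
proof -
  have "apolar n p (monom 1 i) = (\<Sum>j\<le>n. if j = i then fact j * fact (n - j) * coeff p j else 0)"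
    unfolding apolar_def by (intro sum.cong) auto
  then show ?thesis
    using assms by simp
qed

proposition apolar_eq_legendre:
  fixes a x b a' x' b' :: "'a::field_char_0"
  assumes "x ^ 2 - 4 * a * b = 1" and "x' ^ 2 - 4 * a' * b' = 1"
    and "b' = 0 \<Longrightarrow> a' = 0 \<and> x' = 1"
  shows "apolar (2 * l) ([:a, x, b:] ^ l) ([:a', x', b':] ^ l) =
    fact l ^ 2 * legendre l (x * x' + 2 * a * a' + 2 * b * b')"
proof -
  \<comment> \<open>Translation by \<open>c\<close> turns the second quadratic into t + b' t^2: it
    makes the linear coefficient 1, and discriminant 1 then removes the constant term. For
    \<open>b' = 0\<close>, division by zero gives \<open>c = 0\<close>, and by the third assumption
    the quadratic is already t.\<close>
  define c where "c = (1 - x') / (2 * b')"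
  \<comment> \<open>The first quadratic after the matching transposed shear, obtained by solving
    equation \<open>Q\<close> below.\<close>
  define X B where "X = x - 2 * a * c" and "B = b - x * c + a * c ^ 2"
  have x': "x' = 1 - 2 * b' * c"
    using assms(3) by (cases "b' = 0") (auto simp: c_def)
  have a': "a' = b' * c ^ 2 - c"
  proof (cases "b' = 0")
    case True
    then show ?thesis using assms(3) by (simp add: c_def)
  next
    case False
    have "4 * b' * a' = 4 * b' * (b' * c ^ 2 - c)"
      using assms(2) unfolding x' by (simp add: algebra_simps power2_eq_square)
    then show ?thesis
      using False by simp
  qed
  have Q: "[:a, x, b:] = [:a, X + 2 * a * c, B + X * c + a * c ^ 2:]"
    by (simp add: X_def B_def algebra_simps power2_eq_square)
  have Q': "[:a' + x' * c + b' * c ^ 2, x' + 2 * b' * c, b':] = [:0, 1, 0 + 1 * b' + 0 * b' ^ 2:]"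
    by (simp add: x' a' algebra_simps power2_eq_square)
  \<comment> \<open>A second shear, with parameter \<open>b'\<close>, removes the term b' t^2 from
    the second quadratic and translates the first one by \<open>b'\<close>; \<open>C\<close>,
    \<open>W\<close>, \<open>B\<close> are the resulting coefficients.\<close>
  define C W where "C = a + X * b' + B * b' ^ 2" and "W = X + 2 * B * b'"
  have W: "W = x * x' + 2 * a * a' + 2 * b * b'"
    by (simp add: W_def X_def B_def x' a' algebra_simps power2_eq_square)
  have mono: "[:0, 1, 0:] ^ l = monom (1::'a) l"
    by (simp only: monom_altdef smult_1_left pCons_0_0)
  have disc: "W\<^sup>2 - 4 * C * B = 1"
  proof -
    have "W\<^sup>2 - 4 * C * B = x ^ 2 - 4 * a * b"
      by (simp add: W_def C_def X_def B_def algebra_simps power2_eq_square)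
    then show ?thesis
      using assms(1) by simp
  qed
  have "apolar (2 * l) ([:a, x, b:] ^ l) ([:a', x', b':] ^ l) =
        apolar (2 * l) ([:a', x', b':] ^ l) ([:a, X + 2 * a * c, B + X * c + a * c ^ 2:] ^ l)"
    unfolding Q by (rule apolar_commute)
  also have "\<dots> = apolar (2 * l) ([:0, 1, b':] ^ l) ([:a, X, B:] ^ l)"
    unfolding apolar_shift[symmetric] Q' by simp
  \<comment> \<open>The zero terms spell out \<open>[:0, 1, b':]\<close> as the transposed shear of
    \<open>[:0, 1, 0:]\<close>, in the form that \<open>apolar_shift\<close> has on its right-hand
    side.\<close>
  also have "\<dots> = apolar (2 * l) ([:a, X, B:] ^ l) ([:0, 1 + 2 * 0 * b', 0 + 1 * b' + 0 * b' ^ 2:] ^ l)"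
    by (subst apolar_commute) simp
  also have "\<dots> = apolar (2 * l) ([:C, W, B:] ^ l) ([:0, 1, 0:] ^ l)"
    unfolding C_def W_def by (rule apolar_shift[symmetric])
  also have "\<dots> = fact l ^ 2 * coeff ([:C, W, B:] ^ l) l"
    unfolding mono by (subst apolar_monom) (simp_all add: power2_eq_square mult_2)
  also have "\<dots> = fact l ^ 2 * legendre l W"
    by (simp only: middle_coeff_eq_legendre[OF disc])
  finally show ?thesis
    unfolding W .
qed

section \<open>The three-term recurrence of the Legendre polynomials\<close>

lemma legendre_0 [simp]: "legendre 0 w = 1" and legendre_1 [simp]: "legendre (Suc 0) w = w"
  by (simp_all add: legendre_def)

text \<open>For q = u + w t + t^2, the product q q^l and the derivative (l + 1) q' q^l of q^(l + 1)
  give two relations between neighbouring coefficients. Eliminating those off the diagonal leaves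
  the recurrence.\<close>

lemma legendre_rec:
  fixes w :: "'a::field_char_0"
  shows "of_nat (l + 2) * legendre (l + 2) w =
    of_nat (2 * l + 3) * w * legendre (l + 1) w - of_nat (l + 1) * legendre l w"
proof -
  define u where "u = (w ^ 2 - 1) / 4"
  define e where "e l j = coeff ([:u, w, 1:] ^ l) j" for l j
  define b where "b l = e l (Suc l)" for l
  have leg: "legendre l w = e l l" for l
    by (simp add: legendre_def e_def u_def)
  have step: "e (Suc l) (Suc (Suc j)) = u * e l (Suc (Suc j)) + w * e l (Suc j) + e l j" for l j
    unfolding e_def power_Suc by (subst coeff_quadratic_mult) simp
  have "pderiv ([:u, w, 1:] ^ Suc l) = smult (of_nat (Suc l)) ([:w, 2, 0:] * [:u, w, 1:] ^ l)" for l
    by (subst pderiv_power_Suc) (simp add: pderiv_pCons mult_ac)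
  then have "coeff (pderiv ([:u, w, 1:] ^ Suc l)) (Suc j) =
      of_nat (Suc l) * coeff ([:w, 2, 0:] * [:u, w, 1:] ^ l) (Suc j)" for l j
    by (simp only: coeff_smult)
  then have der: "of_nat (Suc (Suc j)) * e (Suc l) (Suc (Suc j)) =
      of_nat (Suc l) * (w * e l (Suc j) + 2 * e l j)" for l j
    unfolding coeff_pderiv coeff_quadratic_mult e_def by simp
  \<comment> \<open>Twice \<open>step\<close> minus \<open>der\<close>, after division by the common
    factor, cancels the coefficient just below the diagonal and leaves \<open>b l\<close>, the one
    just above it.\<close>
  have a: "e (Suc l) (Suc l) = w * e l l + 2 * u * b l" for l
  proof (cases l)
    case 0
    then show ?thesis
      by (simp add: e_def b_def)
  next
    case (Suc k)
    have "of_nat (Suc l) * e (Suc l) (Suc l) = of_nat (Suc l) * (w * e l l + 2 * e l k)"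
      using der[of k l] by (simp only: Suc)
    then have "e (Suc l) (Suc l) = w * e l l + 2 * e l k"
      by (simp only: mult_cancel_left of_nat_eq_0_iff) simp
    moreover have "e (Suc l) (Suc l) = u * b l + w * e l l + e l k"
      using step[of l k] by (simp only: Suc b_def)
    ultimately show ?thesis
      by (simp add: algebra_simps)
  qed
  have b: "of_nat (l + 2) * b (Suc l) = of_nat (l + 1) * (w * b l + 2 * e l l)"
    using der[of l l] by (simp add: b_def)
  have u: "4 * u = w ^ 2 - 1"
    by (simp add: u_def)
  have "of_nat (l + 2) * e (l + 2) (l + 2) =
      of_nat (l + 2) * w * e (Suc l) (Suc l) + 2 * u * (of_nat (l + 2) * b (Suc l))"
    using a[of "Suc l"] by (simp add: algebra_simps)
  also have "\<dots> = of_nat (l + 2) * w * e (Suc l) (Suc l) +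
      of_nat (l + 1) * (w * (2 * u * b l) + 4 * u * e l l)"
    unfolding b by (simp only: algebra_simps) simp
  also have "2 * u * b l = e (Suc l) (Suc l) - w * e l l"
    using a[of l] by simp
  finally show ?thesis
    unfolding leg u by (simp add: algebra_simps power2_eq_square)
qed

section \<open>The plane wave expansion\<close>

text \<open>This is \<open>1 / (2\<^sup>k k! (2 q + 1)!!)\<close>; with \<open>q = l + k\<close> it is, up to sign, the coefficient of \<open>r\<^bsup>l + 2 k\<^esup>\<close> in
  the spherical Bessel function \<open>j\<^sub>l(r)\<close>.\<close>

definition bessel_coeff :: "nat \<Rightarrow> nat \<Rightarrow> real" where
  "bessel_coeff k q = 2 ^ q * fact q / (2 ^ k * fact k * fact (2 * q + 1))"

lemma bessel_coeff_Suc_right: "(2 * real q + 3) * bessel_coeff k (Suc q) = bessel_coeff k q"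
proof -
  have "fact (2 * Suc q + 1) = (2 * real q + 3) * (2 * (real q + 1)) * fact (2 * q + 1)"
    by (simp add: algebra_simps)
  then show ?thesis
    unfolding bessel_coeff_def fact_Suc[of q] \<open>fact (2 * Suc q + 1) = _\<close>
    by (simp add: divide_simps del: fact_Suc)
qed

lemma bessel_coeff_Suc_left: "2 * (real k + 1) * bessel_coeff (Suc k) q = bessel_coeff k q"
  unfolding bessel_coeff_def by (simp add: field_simps del: fact_Suc)  (simp add: algebra_simps)

lemma bessel_coeff_nonneg: "bessel_coeff k q \<ge> 0"
  by (simp add: bessel_coeff_def)

text \<open>Both factorials are needed for the double series: 1 / l! absorbs the geometric growth of
  the Legendre polynomials, and 1 / k! controls the inner sum. They come from 2^q (q!)^2 \<le> (2 q
  + 1)! at q = l + k.\<close>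

lemma bessel_coeff_le: "bessel_coeff k (l + k) \<le> 1 / (fact k * fact l)"
proof -
  have 1: "2 ^ q * fact q * fact q \<le> (fact (2 * q + 1) :: real)" for q
  proof (induction q)
    case (Suc q)
    have "2 ^ Suc q * fact (Suc q) * fact (Suc q) = (2 * (real q + 1) * (real q + 1)) * (2 ^ q * fact q * fact q)"
      by (simp add: algebra_simps)
    also have "\<dots> \<le> ((2 * real q + 3) * (2 * (real q + 1))) * fact (2 * q + 1)"
      using Suc.IH by (intro mult_mono) (auto simp: algebra_simps)
    also have "\<dots> = fact (2 * Suc q + 1)"
      by (simp add: algebra_simps)
    finally show ?case .
  qed simp
  let ?q = "l + k"
  have "bessel_coeff k ?q \<le> 1 / (2 ^ k * fact k * fact ?q)"
    using 1[of ?q] unfolding bessel_coeff_def by (simp add: field_simps del: fact_Suc)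
  also have "\<dots> \<le> 1 / (1 * fact k * fact l)"
    by (intro divide_left_mono mult_mono mult_pos_pos) (auto intro: fact_mono)
  finally show ?thesis
    by simp
qed

lemma bessel_coeff_summable: "summable (\<lambda>k. bessel_coeff k (l + k) * t ^ k)"
proof (rule summable_comparison_test)
  show "\<exists>N. \<forall>k\<ge>N. norm (bessel_coeff k (l + k) * t ^ k) \<le> inverse (fact k) * \<bar>t\<bar> ^ k"
  proof (intro exI allI impI)
    fix k
    have "bessel_coeff k (l + k) \<le> 1 / (fact k * 1)"
      by (rule order_trans[OF bessel_coeff_le]) (intro divide_left_mono mult_mono mult_pos_pos, auto)
    then show "norm (bessel_coeff k (l + k) * t ^ k) \<le> inverse (fact k) * \<bar>t\<bar> ^ k"
      using mult_right_mono[of "bessel_coeff k (l + k)" "1 / fact k" "\<bar>t\<bar> ^ k"]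
      by (simp add: abs_mult power_abs bessel_coeff_nonneg inverse_eq_divide)
  qed
  show "summable (\<lambda>k. inverse (fact k) * \<bar>t\<bar> ^ k)"
    by (rule summable_exp)
qed

text \<open>The coefficient of \<open>legendre l w\<close> in the Legendre expansion of \<open>w ^ n / fact n\<close>.\<close>

definition monomial_coeff :: "nat \<Rightarrow> nat \<Rightarrow> real" where
  "monomial_coeff n l =
     (if l \<le> n \<and> even (n - l) then (2 * real l + 1) * bessel_coeff ((n - l) div 2) ((n + l) div 2) else 0)"

lemma monomial_coeff_add: "monomial_coeff (l + 2 * k) l = (2 * real l + 1) * bessel_coeff k (l + k)"
proof -
  have "(l + 2 * k + l) div 2 = l + k" "(l + 2 * k - l) div 2 = k" "even (l + 2 * k - l)" "l \<le> l + 2 * k"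
    by simp_all
  then show ?thesis
    unfolding monomial_coeff_def by (simp only: if_True simp_thms)
qed

text \<open>This is what comparing coefficients of \<open>legendre j w\<close> gives when the
  expansion of \<open>w ^ n / fact n\<close> is multiplied by \<open>w\<close> and each product is
  expanded by the three-term recurrence.\<close>

lemma monomial_coeff_rec:
  "(real n + 1) * monomial_coeff (Suc n) j =
    (if j = 0 then 0 else real j / (2 * real j - 1) * monomial_coeff n (j - 1)) +
    (real j + 1) / (2 * real j + 3) * monomial_coeff n (Suc j)"
proof (cases "j \<le> Suc n \<and> even (Suc n - j)")
  case False
  have "\<not> (Suc j \<le> n \<and> even (n - Suc j))"
  proof
    assume *: "Suc j \<le> n \<and> even (n - Suc j)"
    from conjunct1[OF this] have "Suc n - j = Suc (Suc (n - Suc j))"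
      by arith
    then show False
      using * False by simp
  qed
  then have 1: "monomial_coeff n (Suc j) = 0"
    unfolding monomial_coeff_def by (rule if_not_P)
  have 2: "monomial_coeff n (j - 1) = 0" if "j \<noteq> 0"
    using False that by (cases j) (auto simp: monomial_coeff_def)
  have 3: "monomial_coeff (Suc n) j = 0"
    using False unfolding monomial_coeff_def by (rule if_not_P)
  show ?thesis
    unfolding 1 3 using 2 by simp
next
  case True
  then obtain k where k: "Suc n = j + 2 * k"
    by (metis dvd_def le_add_diff_inverse)
  \<comment> \<open>All three coefficients are multiples of this one, which reduces the claim to (j
    + 2 k)(2 j + 1) = j (2 (j + k) + 1) + 2 k (j + 1).\<close>
  define b where "b = bessel_coeff k (j + k)"
  have lhs: "monomial_coeff (Suc n) j = (2 * real j + 1) * b"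
    unfolding k b_def by (rule monomial_coeff_add)
  have n: "real n + 1 = real j + 2 * real k"
    using arg_cong[OF k, of real] by simp
  have 1: "(if j = 0 then 0 else real j / (2 * real j - 1) * monomial_coeff n (j - 1)) =
      real j * ((2 * real (j + k) + 1) * b)"
  proof (cases j)
    case (Suc i)
    have n': "n = i + 2 * k"
      using k Suc by simp
    have "monomial_coeff n i = (2 * real i + 1) * bessel_coeff k (i + k)"
      unfolding n' by (rule monomial_coeff_add)
    also have "bessel_coeff k (i + k) = (2 * real (i + k) + 3) * b"
      unfolding b_def Suc using bessel_coeff_Suc_right[of "i + k" k] by (simp add: algebra_simps)
    finally show ?thesis
      by (simp add: Suc field_simps)
  qed simp
  have 2: "(real j + 1) / (2 * real j + 3) * monomial_coeff n (Suc j) = (real j + 1) * (2 * real k * b)"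
  proof (cases k)
    case 0
    then have "n < Suc j" using k by simp
    then show ?thesis by (simp add: 0 monomial_coeff_def)
  next
    case (Suc i)
    have n': "n = Suc j + 2 * i"
      using k Suc by simp
    have "monomial_coeff n (Suc j) = (2 * real j + 3) * bessel_coeff i (j + k)"
      unfolding n' monomial_coeff_add Suc by simp
    also have "bessel_coeff i (j + k) = 2 * real k * b"
      unfolding b_def Suc using bessel_coeff_Suc_left[of i "j + Suc i"] by (simp add: algebra_simps)
    finally show ?thesis
      by (simp add: field_simps)
  qed
  show ?thesis
    unfolding lhs 1 2 n by (simp add: algebra_simps)
qed

section \<open>Monomials in terms of Legendre polynomials, and the double series\<close>

lemma legendre_mult:
  fixes w :: "'a::field_char_0"
  shows "of_nat (2 * l + 1) * w * legendre l w =
    of_nat (l + 1) * legendre (Suc l) w + of_nat l * legendre (l - 1) w"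
proof (cases l)
  case (Suc k)
  then show ?thesis
    using legendre_rec[of k w] by (simp add: algebra_simps)
qed simp

text \<open>Multiplication by \<open>w\<close> sends each Legendre polynomial to its two neighbours;
  collecting terms reproduces \<open>monomial_coeff_rec\<close>.\<close>

lemma monomial_eq_sum_legendre:
  fixes w :: complex
  shows "w ^ n / fact n = (\<Sum>l\<le>n. of_real (monomial_coeff n l) * legendre l w)"
proof (induction n)
  case 0
  then show ?case
    by (simp add: monomial_coeff_def bessel_coeff_def)
next
  case (Suc n)
  let ?c = "\<lambda>n l. complex_of_real (monomial_coeff n l)" and ?P = "\<lambda>l. legendre l w"
  let ?d = "\<lambda>l. complex_of_real (monomial_coeff n l / real (2 * l + 1))"
  have z: "monomial_coeff n l = 0" if "n < l" for l
    using that by (simp add: monomial_coeff_def)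
  have wP: "?c n l * (w * ?P l) = of_nat (l + 1) * ?d l * ?P (Suc l) + of_nat l * ?d l * ?P (l - 1)" for l
  proof -
    have "of_nat (2 * l + 1) \<noteq> (0::complex)"
      by (metis of_nat_eq_0_iff add_is_0 one_neq_zero)
    moreover have "?c n l = of_nat (2 * l + 1) * ?d l"
    proof -
      have nz: "2 * real l + 1 \<noteq> 0" "1 + 2 * real l \<noteq> 0"
        by (smt (verit) of_nat_0_le_iff)+
      have "monomial_coeff n l = (2 * real l + 1) * (monomial_coeff n l / (2 * real l + 1))"
        using nz by simp
      also have "2 * real l + 1 = real (2 * l + 1)"
        by simp
      finally have "monomial_coeff n l = real (2 * l + 1) * (monomial_coeff n l / real (2 * l + 1))" .
      then show ?thesis
        by (metis of_real_mult of_real_of_nat_eq)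
    qed
    ultimately have "?c n l * (w * ?P l) = ?d l * (of_nat (2 * l + 1) * w * ?P l)"
      by (simp only: mult_ac)
    then show ?thesis
      unfolding legendre_mult by (simp only: ring_distribs mult_ac)
  qed
  \<comment> \<open>The two added terms vanish because \<open>monomial_coeff n l = 0\<close> for
    \<open>l > n\<close>; after the index shift this sum has the same range as
    \<open>up\<close>.\<close>
  have "(\<Sum>l\<le>n. of_nat l * ?d l * ?P (l - 1)) = (\<Sum>l\<le>Suc (Suc n). of_nat l * ?d l * ?P (l - 1))"
    by (simp add: z)
  also have "\<dots> = (\<Sum>l\<le>Suc n. of_nat (Suc l) * ?d (Suc l) * ?P l)"
    by (subst sum.atMost_Suc_shift) simp
  finally have down: "(\<Sum>l\<le>n. of_nat l * ?d l * ?P (l - 1)) = \<dots>" .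
  have up: "(\<Sum>l\<le>n. of_nat (l + 1) * ?d l * ?P (Suc l)) = (\<Sum>l\<le>Suc n. of_nat l * ?d (l - 1) * ?P l)"
    by (subst sum.atMost_Suc_shift) simp
  have rec: "of_nat (Suc n) * ?c (Suc n) l = of_nat l * ?d (l - 1) + of_nat (Suc l) * ?d (Suc l)" for l
  proof -
    have "(real n + 1) * monomial_coeff (Suc n) l = real l * (monomial_coeff n (l - 1) / real (2 * (l - 1) + 1))
        + real (Suc l) * (monomial_coeff n (Suc l) / real (2 * Suc l + 1))"
      unfolding monomial_coeff_rec by (cases l) (auto simp: algebra_simps)
    then have "real (Suc n) * monomial_coeff (Suc n) l = real l * (monomial_coeff n (l - 1) / real (2 * (l - 1) + 1))
        + real (Suc l) * (monomial_coeff n (Suc l) / real (2 * Suc l + 1))"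
      by (simp add: add.commute)
    then show ?thesis
      by (metis (no_types) of_real_add of_real_mult of_real_of_nat_eq)
  qed
  have "of_nat (Suc n) * (w ^ Suc n / fact (Suc n)) = w * (w ^ n / fact n)"
    by (simp add: field_simps del: of_nat_Suc)
  also have "\<dots> = (\<Sum>l\<le>n. ?c n l * (w * ?P l))"
    unfolding Suc.IH by (simp add: sum_distrib_left mult_ac)
  also have "\<dots> = (\<Sum>l\<le>Suc n. (of_nat l * ?d (l - 1) + of_nat (Suc l) * ?d (Suc l)) * ?P l)"
    unfolding wP sum.distrib up down by (simp only: ring_distribs sum.distrib)
  also have "\<dots> = of_nat (Suc n) * (\<Sum>l\<le>Suc n. ?c (Suc n) l * ?P l)"
    unfolding rec[symmetric] by (simp only: sum_distrib_left mult_ac)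
  finally show ?case
    by (simp only: mult_cancel_left of_nat_eq_0_iff) simp
qed

text \<open>The base 2 |w| + 1 is chosen so that the recurrence closes: (2 k + 3) |w| + (k + 1)
  \<le> (k + 2)(2 |w| + 1).\<close>

lemma norm_legendre_le: "norm (legendre l w) \<le> (2 * norm w + 1) ^ l" for w :: complex
proof (induction l rule: less_induct)
  case (less l)
  let ?C = "2 * norm w + 1"
  consider "l = 0" | "l = 1" | k where "l = k + 2"
    by (metis add_2_eq_Suc' not0_implies_Suc One_nat_def)
  then show ?case
  proof cases
    case 3
    have C: "?C ^ k \<le> ?C ^ (k + 1)"
      by (intro power_increasing) auto
    have "norm (of_nat (k + 2) * legendre l w) \<le>
       norm (of_nat (2 * k + 3) * w * legendre (k + 1) w) + norm (of_nat (k + 1) * legendre k w)"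
      unfolding 3 legendre_rec by (rule norm_triangle_ineq4)
    also have "\<dots> = real (2 * k + 3) * norm w * norm (legendre (k + 1) w) + real (k + 1) * norm (legendre k w)"
      by (simp only: norm_mult norm_of_nat)
    also have "\<dots> \<le> real (2 * k + 3) * norm w * ?C ^ (k + 1) + real (k + 1) * ?C ^ (k + 1)"
      using less.IH[of "k + 1"] less.IH[of k] 3 C by (intro add_mono mult_left_mono) (auto intro: order_trans)
    also have "\<dots> = (real (2 * k + 3) * norm w + real (k + 1)) * ?C ^ (k + 1)"
      by (simp only: ring_distribs)
    also have "\<dots> \<le> (real (k + 2) * ?C) * ?C ^ (k + 1)"
      by (intro mult_right_mono) (auto simp: algebra_simps)
    also have "\<dots> = real (k + 2) * ?C ^ l"
      by (simp add: 3)
    finally show ?thesis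
      unfolding norm_mult norm_of_nat by (subst (asm) mult_le_cancel_left_pos) auto
  qed auto
qed

text \<open>One absolutely summable family \<open>T (n, l)\<close> is summed in two orders: grouped
  by \<open>n\<close> it gives the exponential series, and grouped by \<open>l\<close>, with n = l +
  2 k, it gives the Bessel power series.\<close>

proposition plane_wave_expansion:
  fixes w :: complex and r :: real
  shows "(\<lambda>l. of_nat (2 * l + 1) * \<i> ^ l * legendre l w *
      of_real (r ^ l * (\<Sum>k. bessel_coeff k (l + k) * (- (r ^ 2)) ^ k))) sums exp (\<i> * of_real r * w)"
proof -
  define C where "C = 2 * norm w + 1"
  define T where "T = (\<lambda>(n, l). (\<i> * of_real r) ^ n * (of_real (monomial_coeff n l) * legendre l w))"
  define g where "g = (\<lambda>(l, k). T (l + 2 * k, l))"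
  define U where "U = Sigma UNIV (\<lambda>n::nat. {l. l \<le> n \<and> even (n - l)})"
  have C: "C \<ge> 1"
    by (simp add: C_def)
  have g: "g (l, k) = of_nat (2 * l + 1) * \<i> ^ l * legendre l w *
      of_real (r ^ l * (bessel_coeff k (l + k) * (- (r ^ 2)) ^ k))" for l k
  proof -
    have 1: "(\<i> * complex_of_real r) ^ (l + 2 * k) = \<i> ^ l * of_real (r ^ l * (- (r ^ 2)) ^ k)"
      by (simp add: power_add power_mult power_mult_distrib flip: power_minus)
    have 2: "monomial_coeff (l + 2 * k) l = real (2 * l + 1) * bessel_coeff k (l + k)"
      by (simp add: monomial_coeff_add)
    show ?thesis
      unfolding g_def T_def prod.case 1 2 by (simp only: of_real_mult of_real_of_nat_eq mult_ac)
  qed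
  have bound: "norm (g (l, k)) \<le> inverse (fact l) * (3 * C * \<bar>r\<bar>) ^ l * (inverse (fact k) * (r ^ 2) ^ k)" for l k
  proof -
    \<comment> \<open>With this the majorant factors into two exponential series, one in
      \<open>l\<close> and one in \<open>k\<close>.\<close>
    have 3: "real (2 * l + 1) \<le> 3 ^ l"
      by (induction l) auto
    have "norm (g (l, k)) = real (2 * l + 1) * norm (legendre l w) * (\<bar>r\<bar> ^ l * (bessel_coeff k (l + k) * (r ^ 2) ^ k))"
      unfolding g norm_mult norm_of_nat norm_power norm_of_real
      by (simp add: abs_mult power_abs bessel_coeff_nonneg)
    also have "\<dots> \<le> 3 ^ l * C ^ l * (\<bar>r\<bar> ^ l * (1 / (fact k * fact l) * (r ^ 2) ^ k))"
      using 3 norm_legendre_le[of l w] C unfolding C_def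
      by (intro mult_mono bessel_coeff_le mult_nonneg_nonneg bessel_coeff_nonneg) auto
    also have "\<dots> = inverse (fact l) * (3 * C * \<bar>r\<bar>) ^ l * (inverse (fact k) * (r ^ 2) ^ k)"
      by (simp add: power_mult_distrib field_simps)
    finally show ?thesis .
  qed
  have exp_summable: "(\<lambda>k. inverse (fact k) * t ^ k) summable_on UNIV" if "t \<ge> 0" for t :: real
    using that by (intro norm_summable_imp_summable_on) (simp add: summable_exp abs_mult)
  have "(\<lambda>(l, k). inverse (fact l) * (3 * C * \<bar>r\<bar>) ^ l * (inverse (fact k) * (r ^ 2) ^ k)) summable_on UNIV \<times> UNIV"
  proof (rule summable_on_SigmaI)
    show "((\<lambda>k. case (l, k) of (l, k) \<Rightarrow> inverse (fact l) * (3 * C * \<bar>r\<bar>) ^ l * (inverse (fact k) * (r ^ 2) ^ k)) has_sum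
        inverse (fact l) * (3 * C * \<bar>r\<bar>) ^ l * (\<Sum>\<^sub>\<infinity>k. inverse (fact k) * (r ^ 2) ^ k)) UNIV" for l
      unfolding prod.case by (intro has_sum_cmult_right has_sum_infsum exp_summable) simp
    show "(\<lambda>l. inverse (fact l) * (3 * C * \<bar>r\<bar>) ^ l * (\<Sum>\<^sub>\<infinity>k. inverse (fact k) * (r ^ 2) ^ k)) summable_on UNIV"
      using C by (intro summable_on_cmult_left exp_summable) auto
  qed (use C in auto)
  then have "(\<lambda>x. norm (g x)) summable_on UNIV \<times> UNIV"
    by (rule Infinite_Sum.abs_summable_on_comparison_test') (use bound in auto)
  then have "g summable_on UNIV \<times> UNIV"
    by (rule abs_summable_summable)
  then obtain S where S: "(g has_sum S) (UNIV \<times> UNIV)"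
    by (auto simp: summable_on_def)
  have "bij_betw (\<lambda>(l::nat, k). (l + 2 * k, l)) (UNIV \<times> UNIV) U"
    unfolding U_def by (rule bij_betw_byWitness[of _ "\<lambda>(n, l). (l, (n - l) div 2)"]) auto
  then have "(T has_sum S) U \<longleftrightarrow> ((\<lambda>x. T (case x of (l, k) \<Rightarrow> (l + 2 * k, l))) has_sum S) (UNIV \<times> UNIV)"
    by (rule has_sum_reindex_bij_betw[symmetric])
  also have "(\<lambda>x. T (case x of (l, k) \<Rightarrow> (l + 2 * k, l))) = g"
    by (auto simp: g_def)
  finally have TU: "(T has_sum S) U"
    using S by simp
  \<comment> \<open>Grouping by \<open>n\<close>: each inner sum is finite and is the Legendre
    expansion of a monomial.\<close>
  have "((\<lambda>n. (\<i> * of_real r * w) ^ n /\<^sub>R fact n) has_sum S) UNIV"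
  proof (rule has_sum_Sigma')
    show "(T has_sum S) (Sigma UNIV (\<lambda>n. {l. l \<le> n \<and> even (n - l)}))"
      using TU unfolding U_def .
    fix n
    have "(\<i> * of_real r * w) ^ n /\<^sub>R fact n = (\<i> * of_real r) ^ n * (w ^ n / fact n)"
      by (simp add: power_mult_distrib scaleR_conv_of_real field_simps)
    also have "\<dots> = (\<Sum>l\<le>n. T (n, l))"
      unfolding monomial_eq_sum_legendre T_def by (simp add: sum_distrib_left)
    also have "\<dots> = (\<Sum>l | l \<le> n \<and> even (n - l). T (n, l))"
      by (intro sum.mono_neutral_right) (auto simp: T_def monomial_coeff_def)
    finally show "((\<lambda>l. T (n, l)) has_sum (\<i> * of_real r * w) ^ n /\<^sub>R fact n) {l. l \<le> n \<and> even (n - l)}"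
      by (intro has_sum_finiteI) auto
  qed
  then have "(\<lambda>n. (\<i> * of_real r * w) ^ n /\<^sub>R fact n) sums S"
    by (rule has_sum_imp_sums)
  then have "S = exp (\<i> * of_real r * w)"
    using exp_converges sums_unique2 by blast
  \<comment> \<open>Grouping by \<open>l\<close>: the sum over \<open>k\<close> is the Bessel power
    series.\<close>
  have inner: "((\<lambda>k. g (l, k)) has_sum of_nat (2 * l + 1) * \<i> ^ l * legendre l w *
      of_real (r ^ l * (\<Sum>k. bessel_coeff k (l + k) * (- (r ^ 2)) ^ k))) UNIV" for l
  proof (rule norm_summable_imp_has_sum)
    show "summable (\<lambda>k. norm (g (l, k)))"
    proof (rule summable_comparison_test')
      show "summable (\<lambda>k. inverse (fact l) * (3 * C * \<bar>r\<bar>) ^ l * (inverse (fact k) * (r ^ 2) ^ k))"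
        by (intro summable_mult summable_exp)
    qed (use bound in auto)
    show "(\<lambda>k. g (l, k)) sums (of_nat (2 * l + 1) * \<i> ^ l * legendre l w *
      of_real (r ^ l * (\<Sum>k. bessel_coeff k (l + k) * (- (r ^ 2)) ^ k)))"
      unfolding g by (intro sums_mult sums_of_real summable_sums bessel_coeff_summable)
  qed
  have "((\<lambda>l. of_nat (2 * l + 1) * \<i> ^ l * legendre l w *
      of_real (r ^ l * (\<Sum>k. bessel_coeff k (l + k) * (- (r ^ 2)) ^ k))) has_sum S) UNIV"
    by (rule has_sum_Sigma'[OF S inner])
  then show ?thesis
    unfolding \<open>S = _\<close> by (rule has_sum_imp_sums)
qed

section \<open>The power series of the spherical Bessel functions\<close>

lemma rGamma_half: "rGamma (real q + 3 / 2) = 2 ^ (2 * q + 1) * fact q / (sqrt pi * fact (2 * q + 1))"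
proof (induction q)
  case 0
  have "rGamma (1 / 2 + 1) * (1 / 2 :: real) = 1 / sqrt pi"
    using rGamma_plus1[of "1 / 2 :: real"] Gamma_one_half_real
    by (simp add: rGamma_inverse_Gamma inverse_eq_divide)
  then show ?case
    by simp
next
  case (Suc q)
  have "(real q + 3 / 2) * rGamma (real (Suc q) + 3 / 2) = rGamma (real q + 3 / 2)"
    using rGamma_plus1[of "real q + 3 / 2"] by (simp add: add_ac)
  then have 1: "rGamma (real (Suc q) + 3 / 2) = 2 * rGamma (real q + 3 / 2) / (2 * real q + 3)"
    by (simp add: field_simps)
  have 2: "fact (2 * Suc q + 1) = (2 * real q + 3) * (2 * (real q + 1)) * fact (2 * q + 1)"
    by (simp add: algebra_simps)
  have 3: "fact (Suc q) = (real q + 1) * fact q" "(2::real) ^ (2 * Suc q + 1) = 4 * 2 ^ (2 * q + 1)"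
    by simp_all
  show ?case
    unfolding 1 2 3 Suc.IH by (simp add: divide_simps del: fact_Suc)
qed

lemma bessel_J_half_integer:
  assumes "r > 0"
  shows "sqrt (pi / (2 * r)) * bessel_J (real l + 1 / 2) r =
    r ^ l * (\<Sum>k. bessel_coeff k (l + k) * (- (r ^ 2)) ^ k)"
proof -
  define s where "s = sqrt (pi / (2 * r))"
  have s: "s > 0"
    using assms by (simp add: s_def)
  have summand: "(-1) ^ k / fact k * rGamma (real l + 1 / 2 + real k + 1) * (r / 2) powr (2 * real k + (real l + 1 / 2)) =
      r ^ l / s * (bessel_coeff k (l + k) * (- (r ^ 2)) ^ k)" for k
  proof -
    have "(r / 2) powr (2 * real k + (real l + 1 / 2)) = (r / 2) powr real (2 * k + l) * (r / 2) powr (1 / 2)"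
      by (simp add: add_ac flip: powr_add)
    also have "\<dots> = (r / 2) ^ (2 * k + l) * sqrt (r / 2)"
      using assms by (simp add: powr_realpow powr_half_sqrt del: of_nat_add of_nat_mult)
    finally have 1: "(r / 2) powr (2 * real k + (real l + 1 / 2)) = (r / 2) ^ (2 * k + l) * sqrt (r / 2)" .
    \<comment> \<open>The half power of \<open>r\<close> in the Bessel series cancels against the
      prefactor; the remaining \<open>sqrt pi\<close> cancels the one from the Gamma function at
      half-integers.\<close>
    have "sqrt (r / 2) * s = sqrt (r / 2 * (pi / (2 * r)))"
      by (simp only: s_def real_sqrt_mult)
    also have "r / 2 * (pi / (2 * r)) = (sqrt pi / 2) ^ 2"
      using assms by (simp add: power_divide)
    also have "sqrt ((sqrt pi / 2) ^ 2) = sqrt pi / 2"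
      by (rule real_sqrt_abs[THEN trans]) simp
    finally have 2: "sqrt (r / 2) = sqrt pi / 2 / s"
      using s by (simp add: field_simps)
    have 3: "rGamma (real l + 1 / 2 + real k + 1) =
        2 ^ (2 * (l + k) + 1) * fact (l + k) / (sqrt pi * fact (2 * (l + k) + 1))"
      using rGamma_half[of "l + k"] by (simp add: add_ac)
    have 4: "(2::real) ^ (2 * (l + k) + 1) = 2 * 2 ^ (l + k) * (2 ^ l * 2 ^ k)"
      unfolding power_add power_even_eq power2_eq_square by simp
    have 5: "(- (r ^ 2)) ^ k = (-1) ^ k * (r ^ k * r ^ k)"
      by (subst power_minus) (simp add: power2_eq_square power_mult_distrib)
    have 6: "(r / 2) ^ (2 * k + l) = r ^ k * r ^ k * r ^ l / (2 ^ k * 2 ^ k * 2 ^ l)"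
      unfolding power_divide power_add power_even_eq power2_eq_square by simp
    show ?thesis
      unfolding 1 2 3 4 5 6 bessel_coeff_def using s by (simp add: divide_simps del: fact_Suc)
  qed
  have "bessel_J (real l + 1 / 2) r = (\<Sum>k. r ^ l / s * (bessel_coeff k (l + k) * (- (r ^ 2)) ^ k))"
    unfolding bessel_J_def summand ..
  also have "\<dots> = r ^ l / s * (\<Sum>k. bessel_coeff k (l + k) * (- (r ^ 2)) ^ k)"
    by (rule suminf_mult[OF bessel_coeff_summable])
  finally show ?thesis
    unfolding s_def[symmetric] using s by simp
qed

lemma sph_bessel_eq:
  assumes "r \<ge> 0"
  shows "sph_bessel l r = r ^ l * (\<Sum>k. bessel_coeff k (l + k) * (- (r ^ 2)) ^ k)"
proof (cases "r = 0")
  case False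
  then show ?thesis
    using assms bessel_J_half_integer by (simp add: sph_bessel_def)
next
  case True
  let ?F = "\<lambda>r::real. r ^ l * (\<Sum>k. bessel_coeff k (l + k) * (- (r ^ 2)) ^ k)"
  let ?G = "\<lambda>t. \<Sum>k. bessel_coeff k (l + k) * t ^ k"
  \<comment> \<open>At 0 the function is defined as a right-hand limit, which continuity of the
    power series evaluates.\<close>
  have "isCont ?G (- (0 ^ 2))"
    by (rule isCont_powser[OF bessel_coeff_summable, of _ 1]) simp
  then have "isCont (\<lambda>r. ?G (- (r ^ 2))) 0"
    by (intro isCont_o2[where g = ?G and f = "\<lambda>r. - (r ^ 2)"] continuous_intros)
  then have "isCont ?F 0"
    by (intro continuous_intros)
  then have "(?F \<longlongrightarrow> ?F 0) (at_right 0)"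
    by (simp add: isCont_def filterlim_at_split)
  moreover have "\<forall>\<^sub>F r in at_right 0. ?F r = sqrt (pi / (2 * r)) * bessel_J (real l + 1 / 2) r"
    using eventually_at_right_less[of "0::real"] by eventually_elim (simp only: bessel_J_half_integer)
  ultimately have "((\<lambda>r. sqrt (pi / (2 * r)) * bessel_J (real l + 1 / 2) r) \<longlongrightarrow> ?F 0) (at_right 0)"
    by (rule Lim_transform_eventually)
  then show ?thesis
    unfolding sph_bessel_def True by (simp add: tendsto_Lim)
qed

section \<open>The addition theorem for complex directions\<close>

lemma higher_deriv_poly: "(deriv ^^ j) (poly p) = poly ((pderiv ^^ j) p)" for p :: "'a::real_normed_field poly"
  by (induction j) (auto intro!: DERIV_imp_deriv poly_DERIV)

lemma poly_higher_pderiv_eq_coeff: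
  fixes p :: "'a::{comm_ring_1,semiring_no_zero_divisors,semiring_char_0} poly"
  shows "poly ((pderiv ^^ j) p) x = fact j * coeff (pcompose p [:x, 1:]) j"
proof -
  have 1: "(pderiv ^^ j) (pcompose p [:x, 1:]) = pcompose ((pderiv ^^ j) p) [:x, 1:]"
    by (induction j) (simp_all add: pderiv_pcompose pderiv_pCons)
  have "coeff ((pderiv ^^ j) q) i * fact i = fact (i + j) * coeff q (i + j)" for q :: "'a poly" and i
  proof (induction j arbitrary: i)
    case (Suc j)
    then show ?case
      using Suc.IH[of "Suc i"] by (simp add: coeff_pderiv mult_ac)
  qed simp
  from this[of "pcompose p [:x, 1:]" 0] show ?thesis
    unfolding 1 by simp
qed

text \<open>Taylor expansion at \<open>x\<close>, using (x + t)^2 - 1 = (x^2 - 1) + 2 x t +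
  t^2.\<close>

lemma higher_deriv_rodrigues:
  "(deriv ^^ j) (\<lambda>t. (t\<^sup>2 - 1) ^ l) x = fact j * coeff ([:x ^ 2 - 1, 2 * x, 1:] ^ l) j" for x :: real
proof -
  have 1: "(\<lambda>t::real. (t\<^sup>2 - 1) ^ l) = poly ([:-1, 0, 1:] ^ l)"
    by (auto simp: power2_eq_square)
  have "pcompose [:-1, 0, 1:] [:x, 1:] = [:x ^ 2 - 1, 2 * x, 1:]"
    by (simp add: pcompose_pCons power2_eq_square)
  then show ?thesis
    unfolding 1 higher_deriv_poly poly_higher_pderiv_eq_coeff pcompose_power by simp
qed

text \<open>Since x^2 - 1 = 4 a b, replacing t by 2 b t turns the Rodrigues quadratic into 4 b (a +
  x t + b t^2). The exponent j - l is the order m.\<close>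

lemma powi_mult_rodrigues_coeff:
  fixes a x b :: real
  assumes "x ^ 2 - 4 * a * b = 1" and "b = 0 \<Longrightarrow> a = 0"
  shows "(2 * b) powi (int j - int l) * coeff ([:x ^ 2 - 1, 2 * x, 1:] ^ l) j =
    2 ^ l * coeff ([:a, x, b:] ^ l) j"
proof (cases "b = 0")
  case False
  have "[:x ^ 2 - 1, 2 * x * (2 * b), 1 * (2 * b) ^ 2:] = smult (4 * b) [:a, x, b:]"
    using assms(1) by (simp add: power2_eq_square algebra_simps)
  then have "(2 * b) ^ j * coeff ([:x ^ 2 - 1, 2 * x, 1:] ^ l) j = (4 * b) ^ l * coeff ([:a, x, b:] ^ l) j"
    by (metis coeff_quadratic_power_scale coeff_smult smult_power)
  also have "(4 * b) ^ l = (2 * b) ^ l * 2 ^ l"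
    unfolding power_mult_distrib[symmetric] by (simp add: mult_ac)
  finally have "(2 * b) ^ j * coeff ([:x ^ 2 - 1, 2 * x, 1:] ^ l) j / (2 * b) ^ l = 2 ^ l * coeff ([:a, x, b:] ^ l) j"
    using False by simp
  moreover have "(2 * b) powi (int j - int l) = (2 * b) ^ j / (2 * b) ^ l"
    using False by (simp add: power_int_diff)
  ultimately show ?thesis
    by simp
next
  case True
  \<comment> \<open>Here the power of 0 is 1 for \<open>j = l\<close> and 0 otherwise, in agreement
    with \<open>[:0, x, 0:] ^ l\<close>, whose only possible nonzero coefficient is the middle
    one.\<close>
  then have a: "a = 0"
    using assms by simp
  show ?thesis
  proof (cases "j = l")
    case True
    have "[:x ^ 2 - 1, 2 * x, 1:] = smult 2 [:(x ^ 2 - 1) / 2, x, 1 / 2:]"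
      by simp
    then have "coeff ([:x ^ 2 - 1, 2 * x, 1:] ^ l) l = 2 ^ l * coeff ([:(x ^ 2 - 1) / 2, x, 1 / 2:] ^ l) l"
      by (metis coeff_smult smult_power)
    also have "coeff ([:(x ^ 2 - 1) / 2, x, 1 / 2:] ^ l) l = coeff ([:a, x, b:] ^ l) l"
      using assms(1) by (subst (1 2) middle_coeff_eq_legendre) (simp_all add: diff_divide_distrib)
    finally show ?thesis
      using True by simp
  next
    case False
    have "[:a, x, b:] ^ l = smult (x ^ l) (monom 1 l)"
    proof -
      have "[:a, x, b:] = smult x [:0, 1:]"
        using a \<open>b = 0\<close> by simp
      then show ?thesis
        by (simp only: monom_altdef smult_power smult_1_left)
    qed
    then show ?thesis
      using False \<open>b = 0\<close> by simp
  qed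
qed

text \<open>With s = sqrt(1 - x^2), the choice b = -s / 2 makes the discriminant x^2 + s^2 = 1, and
  its sign supplies the phase (-1)^m of the Ferrers function.\<close>

lemma ferrers_eq_coeff:
  assumes "\<bar>x\<bar> \<le> 1"
  shows "ferrers l (int j - int l) x =
    fact j / fact l * coeff ([:sqrt (1 - x\<^sup>2) / 2, x, - (sqrt (1 - x\<^sup>2) / 2):] ^ l) j"
proof -
  define s where "s = sqrt (1 - x\<^sup>2)"
  have "s ^ 2 = 1 - x ^ 2"
    using assms by (simp add: s_def abs_square_le_1)
  then have "x ^ 2 - 4 * (s / 2) * (- (s / 2)) = 1"
    by (simp add: power2_eq_square)
  from powi_mult_rodrigues_coeff[OF this, of j l]
  have "(-s) powi (int j - int l) * coeff ([:x ^ 2 - 1, 2 * x, 1:] ^ l) j =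
      2 ^ l * coeff ([:s / 2, x, - (s / 2):] ^ l) j"
    by simp
  moreover have "(-s) powi (int j - int l) = (-1) powi (int j - int l) * s powi (int j - int l)"
    by (simp flip: power_int_mult_distrib)
  ultimately have "(-1) powi (int j - int l) * s powi (int j - int l) * coeff ([:x ^ 2 - 1, 2 * x, 1:] ^ l) j =
      2 ^ l * coeff ([:s / 2, x, - (s / 2):] ^ l) j"
    by simp
  then show ?thesis
    unfolding ferrers_def higher_deriv_rodrigues s_def[symmetric] by (simp add: field_simps)
qed

lemma assoc_legendre_eq_coeff:
  assumes "z \<ge> 1"
  shows "assoc_legendre l (int j - int l) z =
    fact j / fact l * coeff ([:sqrt (z\<^sup>2 - 1) / 2, z, sqrt (z\<^sup>2 - 1) / 2:] ^ l) j"
proof -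
  define s where "s = sqrt (z\<^sup>2 - 1)"
  have "s ^ 2 = z ^ 2 - 1"
    using assms by (simp add: s_def)
  then have "z ^ 2 - 4 * (s / 2) * (s / 2) = 1"
    by (simp add: power2_eq_square)
  from powi_mult_rodrigues_coeff[OF this, of j l]
  have "s powi (int j - int l) * coeff ([:z ^ 2 - 1, 2 * z, 1:] ^ l) j =
      2 ^ l * coeff ([:s / 2, z, s / 2:] ^ l) j"
    by simp
  then show ?thesis
    unfolding assoc_legendre_def higher_deriv_rodrigues s_def[symmetric] by (simp add: field_simps)
qed

lemma of_real_coeff_quadratic_power:
  "of_real (coeff ([:a, b, c:] ^ l) j) =
    (coeff ([:of_real a, of_real b, of_real c:] ^ l) j :: 'a::{real_algebra_1,comm_ring_1})"
proof (induction l arbitrary: j)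
  case (Suc l)
  then show ?case
    by (simp only: power_Suc coeff_quadratic_mult if_distrib[of of_real] of_real_add of_real_mult of_real_0)
qed simp

text \<open>A factor k^m with m = j - l is absorbed into the outer coefficients; their product,
  hence the discriminant, is unchanged.\<close>

lemma powi_mult_coeff_quadratic_power:
  fixes k :: "'a::field"
  assumes "k \<noteq> 0"
  shows "k powi (int j - int l) * coeff ([:a, b, c:] ^ l) j = coeff ([:a / k, b, c * k:] ^ l) j"
proof -
  have "[:a, b * k, c * k ^ 2:] = smult k [:a / k, b, c * k:]"
    using assms by (simp add: power2_eq_square)
  then have "k ^ j * coeff ([:a, b, c:] ^ l) j = k ^ l * coeff ([:a / k, b, c * k:] ^ l) j"
    by (metis coeff_quadratic_power_scale coeff_smult smult_power)
  then show ?thesis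
    using assms by (simp add: power_int_diff divide_simps mult_ac)
qed

text \<open>With m = j - l, the squared normalisation contributes (2 l - j)! / j! and each Legendre
  function j! / l! times a coefficient. The product has exactly the weights j! (2 l - j)! of the
  apolar pairing. The argument of \<open>legendre\<close> is the bilinear product of
  \<open>d_up z\<close> with the unit vector.\<close>

proposition complex_addition_theorem:
  assumes "z \<ge> 1" "0 \<le> \<theta>1" "\<theta>1 \<le> pi"
  shows "(\<Sum>m = - int l..int l. sph_harm_d_up l m z * sph_harm l m (sph_point \<theta>1 \<theta>2)) =
    of_real ((2 * real l + 1) / (4 * pi)) *
    legendre l (of_real (z * cos \<theta>1) + \<i> * of_real (sqrt (z\<^sup>2 - 1) * sin \<theta>1 * cos \<theta>2))"
proof -
  define x s S where "x = cos \<theta>1" and "s = sin \<theta>1" and "S = sqrt (z\<^sup>2 - 1)"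
  \<comment> \<open>Its m-th power combines the azimuthal phase with the factor
    \<open>\<i> powi (- m)\<close> of the complex direction.\<close>
  define \<omega> where "\<omega> = cis \<theta>2 / \<i>"
  define e e' where "e j = coeff ([:complex_of_real (s / 2), of_real x, of_real (- (s / 2)):] ^ l) j"
    and "e' j = coeff ([:complex_of_real (S / 2) / \<omega>, of_real z, of_real (S / 2) * \<omega>:] ^ l) j" for j
  have \<omega>: "\<omega> \<noteq> 0"
    by (simp add: \<omega>_def)
  have s: "sqrt (1 - x\<^sup>2) = s"
    using assms by (simp add: x_def s_def sin_ge_zero flip: sin_squared_eq)
  have summand: "sph_harm_d_up l (int j - int l) z * sph_harm l (int j - int l) (sph_point \<theta>1 \<theta>2) =
      of_real ((2 * real l + 1) / (4 * pi)) * ((fact j * fact (2 * l - j) * e j * e' j) / (fact l) ^ 2)"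
    if j: "j \<le> 2 * l" for j
  proof -
    let ?m = "int j - int l"
    have "(sph_norm l ?m) ^ 2 = (2 * real l + 1) / (4 * pi) * (fact (2 * l - j) / fact j)"
    proof -
      have "nat (int l - ?m) = 2 * l - j" "nat (int l + ?m) = j"
        using j by auto
      then show ?thesis
        by (simp add: sph_norm_def)
    qed
    from arg_cong[OF this, of complex_of_real]
    have 1: "of_real (sph_norm l ?m) * of_real (sph_norm l ?m) =
       complex_of_real ((2 * real l + 1) / (4 * pi)) * (fact (2 * l - j) / fact j)"
      by (simp add: power2_eq_square)
    have 2: "\<i> powi (- ?m) * exp (\<i> * of_int ?m * of_real \<theta>2) = \<omega> powi ?m"
      unfolding exp_int_angle \<omega>_def power_int_divide_distrib power_int_minus by (simp add: field_simps)
    have 3: "complex_of_real (ferrers l ?m (cos \<theta>1)) = fact j / fact l * e j"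
      unfolding x_def[symmetric] e_def of_real_coeff_quadratic_power[symmetric]
      by (subst ferrers_eq_coeff) (simp_all add: x_def s[unfolded x_def])
    have 4: "\<omega> powi ?m * complex_of_real (assoc_legendre l ?m z) = fact j / fact l * e' j"
      unfolding e'_def powi_mult_coeff_quadratic_power[OF \<omega>, symmetric] of_real_coeff_quadratic_power[symmetric]
      by (subst assoc_legendre_eq_coeff) (simp_all add: assms S_def)
    have "sph_harm_d_up l ?m z * sph_harm l ?m (sph_point \<theta>1 \<theta>2) =
       (of_real (sph_norm l ?m) * of_real (sph_norm l ?m)) *
       ((\<i> powi (- ?m) * exp (\<i> * of_int ?m * of_real \<theta>2)) * of_real (assoc_legendre l ?m z)) *
       of_real (ferrers l ?m (cos \<theta>1))"
      unfolding sph_harm_d_up_def sph_harm_sph_point[OF assms(2,3)] by (simp only: mult_ac)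
    also have "\<dots> = complex_of_real ((2 * real l + 1) / (4 * pi)) * (fact (2 * l - j) / fact j) *
       (fact j / fact l * e' j) * (fact j / fact l * e j)"
      unfolding 1 2 3 4 ..
    finally show ?thesis
      by (simp add: power2_eq_square mult_ac)
  qed
  have key: "(\<Sum>j\<le>2 * l. fact j * fact (2 * l - j) * e j * e' j) = (fact l) ^ 2 * legendre l
    (of_real x * of_real z + 2 * complex_of_real (s / 2) * (complex_of_real (S / 2) / \<omega>)
      + 2 * of_real (- (s / 2)) * (of_real (S / 2) * \<omega>))"
    unfolding e_def e'_def apolar_def[symmetric]
  proof (rule apolar_eq_legendre)
    have "x ^ 2 - 4 * (s / 2) * (- (s / 2)) = 1"
      unfolding x_def s_def by (simp flip: power2_eq_square)
    then have "complex_of_real (x ^ 2 - 4 * (s / 2) * (- (s / 2))) = 1"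
      by (simp only: of_real_1)
    then show "(complex_of_real x)\<^sup>2 - 4 * complex_of_real (s / 2) * complex_of_real (- (s / 2)) = 1"
      by (simp only: of_real_diff of_real_mult of_real_power of_real_numeral)
    have "z ^ 2 - 4 * (S / 2) * (S / 2) = 1"
      using assms unfolding S_def by (simp flip: power2_eq_square)
    then have "complex_of_real (z ^ 2 - 4 * (S / 2) * (S / 2)) = 1"
      by (simp only: of_real_1)
    then have "(complex_of_real z)\<^sup>2 - 4 * complex_of_real (S / 2) * complex_of_real (S / 2) = 1"
      by (simp only: of_real_diff of_real_mult of_real_power of_real_numeral)
    then show "(complex_of_real z)\<^sup>2 - 4 * (complex_of_real (S / 2) / \<omega>) * (complex_of_real (S / 2) * \<omega>) = 1"
      using \<omega> by simp
    \<comment> \<open>The degenerate case z = 1, where \<open>d_up z\<close> is the real north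
      pole.\<close>
    assume "complex_of_real (S / 2) * \<omega> = 0"
    then have "S = 0"
      using \<omega> by simp
    then have "z = 1"
      using assms by (auto simp: S_def power2_eq_1_iff)
    then show "complex_of_real (S / 2) / \<omega> = 0 \<and> complex_of_real z = 1"
      using \<open>S = 0\<close> by simp
  qed
  have arg: "of_real x * of_real z + 2 * complex_of_real (s / 2) * (complex_of_real (S / 2) / \<omega>)
      + 2 * of_real (- (s / 2)) * (of_real (S / 2) * \<omega>) =
      of_real (z * x) + \<i> * of_real (S * s * cos \<theta>2)"
  proof -
    have "1 / \<omega> = \<i> * cis (- \<theta>2)" and "\<omega> = - \<i> * cis \<theta>2"
      by (simp_all add: \<omega>_def divide_inverse cis_inverse)
    then have "1 / \<omega> - \<omega> = \<i> * cis (- \<theta>2) - (- \<i> * cis \<theta>2)"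
      by (rule arg_cong2[where f = minus])
    also have "\<dots> = 2 * \<i> * of_real (cos \<theta>2)"
      by (simp add: complex_eq_iff)
    finally have "1 / \<omega> - \<omega> = 2 * \<i> * of_real (cos \<theta>2)" .
    then have 1: "complex_of_real (S * s / 2) * (1 / \<omega> - \<omega>) = \<i> * of_real (S * s * cos \<theta>2)"
      by simp
    show ?thesis
      unfolding 1[symmetric] using \<omega> by (simp add: field_simps)
  qed
  have "(\<Sum>m = - int l..int l. sph_harm_d_up l m z * sph_harm l m (sph_point \<theta>1 \<theta>2)) =
     (\<Sum>j\<le>2 * l. sph_harm_d_up l (int j - int l) z * sph_harm l (int j - int l) (sph_point \<theta>1 \<theta>2))"
    by (rule sum.reindex_bij_witness[of _ "\<lambda>j. int j - int l" "\<lambda>m. nat (m + int l)"]) auto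
  also have "\<dots> = of_real ((2 * real l + 1) / (4 * pi)) * ((\<Sum>j\<le>2 * l. fact j * fact (2 * l - j) * e j * e' j) / (fact l) ^ 2)"
    by (simp add: summand sum_distrib_left sum_divide_distrib)
  also have "\<dots> = of_real ((2 * real l + 1) / (4 * pi)) * legendre l (of_real (z * x) + \<i> * of_real (S * s * cos \<theta>2))"
    unfolding key arg by simp
  finally show ?thesis
    unfolding x_def s_def S_def .
qed

section \<open>From angles to unit vectors\<close>

lemma unit_vector_eq_sph_point:
  assumes "norm (u :: real ^ 3) = 1"
  obtains \<theta>1 \<theta>2 where "0 \<le> \<theta>1" "\<theta>1 \<le> pi" "u = sph_point \<theta>1 \<theta>2"
proof -
  have u: "(u $ 1)\<^sup>2 + (u $ 2)\<^sup>2 + (u $ 3)\<^sup>2 = 1"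
    using assms by (simp add: norm_eq_sqrt_inner inner_vec_def sum_3 power2_eq_square)
  define \<theta>1 where "\<theta>1 = arccos (u $ 3)"
  have u3: "\<bar>u $ 3\<bar> \<le> 1"
    using u by (simp add: add_nonneg_nonneg flip: abs_square_le_1) (smt (verit) zero_le_power2)
  have c: "cos \<theta>1 = u $ 3" and \<theta>1: "0 \<le> \<theta>1" "\<theta>1 \<le> pi"
    using u3 by (auto simp: \<theta>1_def cos_arccos_abs abs_le_iff intro: arccos_lbound arccos_ubound)
  have s: "(sin \<theta>1)\<^sup>2 = (u $ 1)\<^sup>2 + (u $ 2)\<^sup>2"
    using u by (simp add: sin_squared_eq c)
  obtain \<theta>2 where "u $ 1 = sin \<theta>1 * cos \<theta>2" "u $ 2 = sin \<theta>1 * sin \<theta>2"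
  proof (cases "sin \<theta>1 = 0")
    \<comment> \<open>At the poles every azimuth represents the point; 0 is taken.\<close>
    case True
    then show ?thesis
      using s that[of 0] by (simp add: sum_power2_eq_zero_iff)
  next
    case False
    then have "(u $ 1 / sin \<theta>1)\<^sup>2 + (u $ 2 / sin \<theta>1)\<^sup>2 = 1"
      by (simp add: power_divide s[symmetric] flip: add_divide_distrib)
    then obtain t where "u $ 1 / sin \<theta>1 = cos t" "u $ 2 / sin \<theta>1 = sin t"
      using sincos_total_2pi by metis
    then show ?thesis
      using False by (intro that[of t]) (auto simp: field_simps)
  qed
  then show thesis
    using \<theta>1 c by (intro that[of \<theta>1 \<theta>2]) (auto simp: sph_point_def vec_eq_iff forall_3)
qed

text \<open>The plane wave expansion at radius \<kappa> |x|, with each Legendre polynomial expanded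
  by the addition theorem. The separate \<open>u\<close> makes the direction arbitrary at x =
  0.\<close>

lemma plane_wave_d_up_expansion:
  fixes u x :: "real ^ 3"
  assumes "\<kappa> > 0" "norm u = 1" "x = norm x *\<^sub>R u" "z \<ge> 1"
  shows "(\<lambda>l. of_real (4 * pi) * (\<i> ^ l * (\<Sum>m = - int l..int l.
      sph_harm_d_up l m z * sph_harm l m u * of_real (sph_bessel l (\<kappa> * norm x)))))
    sums plane_wave \<kappa> (d_up z) x"
proof -
  define r where "r = norm x"
  obtain \<theta>1 \<theta>2 where \<theta>: "0 \<le> \<theta>1" "\<theta>1 \<le> pi" and u: "u = sph_point \<theta>1 \<theta>2"
    using unit_vector_eq_sph_point[OF assms(2)] .
  define w where "w = of_real (z * cos \<theta>1) + \<i> * complex_of_real (sqrt (z\<^sup>2 - 1) * sin \<theta>1 * cos \<theta>2)"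
  have x: "x = r *\<^sub>R sph_point \<theta>1 \<theta>2"
    using assms(3) by (simp only: r_def u)
  have "cdot (d_up z) (cvec x) = of_real r * w"
    unfolding x by (simp add: cdot_def d_up_def cvec_def sum_3 sph_point_def w_def algebra_simps)
  then have wave: "plane_wave \<kappa> (d_up z) x = exp (\<i> * of_real (\<kappa> * r) * w)"
    by (simp add: plane_wave_def mult_ac)
  have "of_real (4 * pi) * (\<i> ^ l * (\<Sum>m = - int l..int l.
      sph_harm_d_up l m z * sph_harm l m u * of_real (sph_bessel l (\<kappa> * norm x)))) =
    of_nat (2 * l + 1) * \<i> ^ l * legendre l w *
      of_real ((\<kappa> * r) ^ l * (\<Sum>k. bessel_coeff k (l + k) * (- ((\<kappa> * r) ^ 2)) ^ k))" for l
  proof -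
    have "complex_of_real (4 * pi) * of_real ((2 * real l + 1) / (4 * pi)) = of_nat (2 * l + 1)"
      by simp
    then show ?thesis
      unfolding sum_distrib_right[symmetric] u complex_addition_theorem[OF assms(4) \<theta>] w_def[symmetric] r_def[symmetric]
      by (subst sph_bessel_eq) (use assms(1) in \<open>simp_all only: r_def mult_ac, simp_all\<close>)
  qed
  then show ?thesis
    unfolding wave by (simp only: plane_wave_expansion)
qed

section \<open>Rotations and the general direction\<close>

lemma orthogonal_matrix_rot_y: "orthogonal_matrix (rot_y t)"
  unfolding orthogonal_matrix matrix_matrix_mult_def vec_eq_iff forall_3 sum_3 vec_lambda_beta
  by (simp add: transpose_def mat_def rot_y_def flip: power2_eq_square)

lemma orthogonal_matrix_rot_z: "orthogonal_matrix (rot_z t)"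
  unfolding orthogonal_matrix matrix_matrix_mult_def vec_eq_iff forall_3 sum_3 vec_lambda_beta
  by (simp add: transpose_def mat_def rot_z_def flip: power2_eq_square)

lemma orthogonal_matrix_rot: "orthogonal_matrix (rot \<theta>)"
  by (cases \<theta>) (simp add: rot_def orthogonal_matrix_mul orthogonal_matrix_rot_y orthogonal_matrix_rot_z)

lemma matrix_inv_orthogonal:
  assumes "orthogonal_matrix (A :: real ^ 'n ^ 'n)"
  shows "matrix_inv A = transpose A"
proof -
  have A: "transpose A ** A = mat 1" "A ** transpose A = mat 1"
    using assms by (simp_all add: orthogonal_matrix_def)
  then have "\<exists>B. A ** B = mat 1 \<and> B ** A = mat 1"
    by blast
  then have inv: "A ** matrix_inv A = mat 1 \<and> matrix_inv A ** A = mat 1"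
    unfolding matrix_inv_def by (rule someI_ex)
  have "matrix_inv A = matrix_inv A ** (A ** transpose A)"
    by (simp add: A)
  also have "\<dots> = (matrix_inv A ** A) ** transpose A"
    by (rule matrix_mul_assoc)
  finally show ?thesis
    by (simp add: inv)
qed

lemma cdot_matrix_vector_mult:
  "cdot (map_matrix of_real A *v d) (cvec x) = cdot d (cvec (transpose A *v x))"
  unfolding cdot_def
  by (simp add: cvec_def sum_3 matrix_vector_mult_def transpose_def map_matrix_def algebra_simps)

theorem theorem4p7:
  fixes \<kappa> :: real
  assumes "\<kappa> > 0"
  shows
    "(\<forall>x \<in> ball 0 1. \<forall>(u :: real ^ 3) (z :: real). norm u = 1 \<longrightarrow> x = norm x *\<^sub>R u \<longrightarrow> z \<ge> 1 \<longrightarrow>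
        (\<lambda>l. of_real (4 * pi) * (\<i> ^ l * (\<Sum>m = - int l..int l.
            sph_harm_d_up l m z * sph_harm l m u * of_real (sph_bessel l (\<kappa> * norm x)))))
        sums plane_wave \<kappa> (d_up z) x)
     \<and>
     (\<forall>x \<in> ball 0 1. \<forall>u \<theta> \<zeta>. norm u = 1 \<longrightarrow> x = norm x *\<^sub>R u \<longrightarrow> (\<theta>, \<zeta>) \<in> Theta \<times> {0..} \<longrightarrow>
        (\<lambda>l. of_real (4 * pi) * (\<i> ^ l * (\<Sum>m = - int l..int l.
            sph_harm_d_up l m (\<zeta> / (2 * \<kappa>) + 1) * sph_harm l m (matrix_inv (rot \<theta>) *v u) *
            of_real (sph_bessel l (\<kappa> * norm x)))))
        sums evanescent_wave \<kappa> (\<theta>, \<zeta>) x)"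
proof (intro conjI ballI allI impI)
  fix x u :: "real ^ 3" and z :: real
  assume "norm u = 1" "x = norm x *\<^sub>R u" "z \<ge> 1"
  then show "(\<lambda>l. of_real (4 * pi) * (\<i> ^ l * (\<Sum>m = - int l..int l.
            sph_harm_d_up l m z * sph_harm l m u * of_real (sph_bessel l (\<kappa> * norm x)))))
        sums plane_wave \<kappa> (d_up z) x"
    using assms by (intro plane_wave_d_up_expansion)
next
  fix x u :: "real ^ 3" and \<theta> and \<zeta> :: real
  assume u: "norm u = 1" and x: "x = norm x *\<^sub>R u" and y: "(\<theta>, \<zeta>) \<in> Theta \<times> {0..}"
  define R where "R = transpose (rot \<theta>)"
  have inv: "matrix_inv (rot \<theta>) = R"
    unfolding R_def by (rule matrix_inv_orthogonal[OF orthogonal_matrix_rot])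
  have "orthogonal_transformation ((*v) R)"
    by (simp add: R_def orthogonal_matrix_rot orthogonal_transformation_matrix)
  then have norm_R: "norm (R *v v) = norm v" for v
    by (rule orthogonal_transformation_norm)
  \<comment> \<open>The first expansion is applied at the rotated point, whose direction is
    \<open>R *v u\<close> and whose norm is that of \<open>x\<close>.\<close>
  have "R *v x = norm (R *v x) *\<^sub>R (R *v u)"
    unfolding norm_R by (subst x) (simp add: matrix_vector_mult_scaleR)
  moreover have "1 \<le> \<zeta> / (2 * \<kappa>) + 1"
    using y assms by simp
  ultimately have "(\<lambda>l. of_real (4 * pi) * (\<i> ^ l * (\<Sum>m = - int l..int l.
            sph_harm_d_up l m (\<zeta> / (2 * \<kappa>) + 1) * sph_harm l m (R *v u) *
            of_real (sph_bessel l (\<kappa> * norm (R *v x))))))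
        sums plane_wave \<kappa> (d_up (\<zeta> / (2 * \<kappa>) + 1)) (R *v x)"
    using assms u by (intro plane_wave_d_up_expansion) (simp_all add: norm_R)
  moreover have "plane_wave \<kappa> (d_up (\<zeta> / (2 * \<kappa>) + 1)) (R *v x) = evanescent_wave \<kappa> (\<theta>, \<zeta>) x"
    by (simp add: evanescent_wave_def plane_wave_def direction_def cdot_matrix_vector_mult R_def)
  ultimately show "(\<lambda>l. of_real (4 * pi) * (\<i> ^ l * (\<Sum>m = - int l..int l.
            sph_harm_d_up l m (\<zeta> / (2 * \<kappa>) + 1) * sph_harm l m (matrix_inv (rot \<theta>) *v u) *
            of_real (sph_bessel l (\<kappa> * norm x)))))
        sums evanescent_wave \<kappa> (\<theta>, \<zeta>) x"
    by (simp only: inv norm_R)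
qed

end
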